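(* Let $G_1$ and $G_2$ be signed complexes representing elements of the strong ring. If $\lambda_1$ is an eigenvalue of the Dirac operator $D(G_1)$ and $\lambda_2$ is an eigenvalue of the Dirac operator $D(G_2)$, then there is an eigenvalue $\lambda_{12}$ of $D(G_1\times G_2)$ such that $\lambda_1^2+\lambda_2^2=\lambda_{12}^2$.
   Context: A finite abstract simplicial complex is a finite set of finite non-empty sets which is closed under taking non-empty subsets; $\dim(x)=|x|-1$. A product complex is a finite Cartesian product of finite abstract simplicial complexes; its cells are the products $x=x_1\times\cdots\times x_n$ of simplices of the factors, with $\dim(x)=\sum_i\dim(x_i)$. A signed complex is a finite formal disjoint union of product complexes, each summand carrying a sign in $\{1,-1\}$; products are taken term by term with signs multiplied (no cancellation is performed). Elements of the strong ring are represented by signed complexes. Fix an arbitrary orientation of each simplex, with boundary operation $\delta$. The exterior derivative of a simplicial complex acts on functions on its simplices by $df(x)=f(\delta x)$; for a product of two complexes with boundary operations $\delta_1,\delta_2$ it acts on functions on cells by $df(x,y)=f(\delta_1x,y)+(-1)^{\dim(x)}f(x,\delta_2y)$, and iteratively for more factors. The Dirac operator of a product complex is the symmetric matrix $D=d+d^*$, with $d^*$ the transpose of $d$. For a signed complex, $D$ is the direct sum of the matrices $\varepsilon_iD(G_i)$ over the summands $G_i$ with signs $\varepsilon_i$. *)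

theory Defs
  imports "Jordan_Normal_Form.Char_Poly" "HOL-Combinatorics.Permutations"
begin

definition simplicial_complex :: "'a set set \<Rightarrow> bool" where
  "simplicial_complex K \<longleftrightarrow>
     finite K \<and> (\<forall>x\<in>K. finite x \<and> x \<noteq> {}) \<and> (\<forall>x\<in>K. \<forall>y. y \<subseteq> x \<and> y \<noteq> {} \<longrightarrow> y \<in> K)"

definition simplex_dim :: "'a set \<Rightarrow> nat" where
  "simplex_dim x = card x - 1"

text \<open>
  An orientation of a simplex is an ordering of its vertices up to even permutations; it is
  represented by one such ordering, and the boundary below depends only on the class it represents.
\<close>

record 'a ocomplex =
  simplices :: "'a set set"
  orient :: "'a set \<Rightarrow> 'a list"

definition oriented_complex :: "'a ocomplex \<Rightarrow> bool" where
  "oriented_complex K \<longleftrightarrow> simplicial_complex (simplices K) \<and>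
     (\<forall>x\<in>simplices K. distinct (orient K x) \<and> set (orient K x) = x)"

text \<open>The sign of the permutation relating two orderings of the same finite set.\<close>

definition relative_sign :: "'a list \<Rightarrow> 'a list \<Rightarrow> int" where
  "relative_sign xs ys = sign (THE p. p permutes {..<length xs} \<and> permute_list p xs = ys)"

definition omit_nth :: "nat \<Rightarrow> 'a list \<Rightarrow> 'a list" where
  "omit_nth i xs = take i xs @ drop (Suc i) xs"

text \<open>
  The coefficient of y in the formal sum \<open>\<delta>x = \<Sum>i. (-1)^i [v0,...,vi omitted,...,vk]\<close>, where
  \<open>[v0,...,vk]\<close> is the chosen ordering of x and each face is rewritten as plus or minus the
  oriented simplex of the complex.
\<close>

definition boundary_coeff :: "'a ocomplex \<Rightarrow> 'a set \<Rightarrow> 'a set \<Rightarrow> int" where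
  "boundary_coeff K x y =
     (\<Sum>i | i < length (orient K x) \<and> set (omit_nth i (orient K x)) = y.
        (-1) ^ i * relative_sign (omit_nth i (orient K x)) (orient K y))"

text \<open>
  \<open>f(\<delta>x)\<close>; the sum runs over simplices only, so the empty face of a vertex does not contribute.
\<close>

definition simplex_deriv :: "'a ocomplex \<Rightarrow> ('a set \<Rightarrow> real) \<Rightarrow> 'a set \<Rightarrow> real" where
  "simplex_deriv K f x = (\<Sum>y\<in>simplices K. of_int (boundary_coeff K x y) * f y)"

text \<open>
  A product complex is the list of its factors, and the cell \<open>x\<^sub>1 \<times> \<dots> \<times> x\<^sub>n\<close> is the list of the
  simplices \<open>x\<^sub>i\<close>. The empty list is the empty product, which has the single cell \<open>[]\<close>.
\<close>

type_synonym 'a product_complex = "'a ocomplex list"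

definition cells :: "'a product_complex \<Rightarrow> 'a set list set" where
  "cells P = listset (map simplices P)"

fun ext_deriv :: "'a product_complex \<Rightarrow> ('a set list \<Rightarrow> real) \<Rightarrow> 'a set list \<Rightarrow> real" where
  "ext_deriv (K # P) f (x # xs) =
     simplex_deriv K (\<lambda>y. f (y # xs)) x
     + (-1) ^ simplex_dim x * ext_deriv P (\<lambda>ys. f (x # ys)) xs"
| "ext_deriv _ _ _ = 0"

text \<open>
  Matrices are indexed by an arbitrary enumeration of the cells; another enumeration conjugates
  the matrix by a permutation matrix.
\<close>

definition cell_list :: "'a product_complex \<Rightarrow> 'a set list list" where
  "cell_list P = (SOME cs. distinct cs \<and> set cs = cells P)"

definition ext_deriv_mat :: "'a product_complex \<Rightarrow> real mat" where
  "ext_deriv_mat P =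
     (let cs = cell_list P; n = length cs
      in mat n n (\<lambda>(i, j). ext_deriv P (\<lambda>c. if c = cs ! j then 1 else 0) (cs ! i)))"

definition product_dirac :: "'a product_complex \<Rightarrow> real mat" where
  "product_dirac P = ext_deriv_mat P + transpose_mat (ext_deriv_mat P)"

text \<open>Formal disjoint unions are lists of signed summands; equal summands are never cancelled.\<close>

type_synonym 'a signed_complex = "(int \<times> 'a product_complex) list"

definition signed_complex :: "'a signed_complex \<Rightarrow> bool" where
  "signed_complex G \<longleftrightarrow>
     (\<forall>(s, P)\<in>set G. s \<in> {1, -1} \<and> (\<forall>K\<in>set P. oriented_complex K))"

definition signed_product :: "'a signed_complex \<Rightarrow> 'a signed_complex \<Rightarrow> 'a signed_complex" where
  "signed_product G H = map (\<lambda>((s, P), (t, Q)). (s * t, P @ Q)) (List.product G H)"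

definition dirac :: "'a signed_complex \<Rightarrow> real mat" where
  "dirac G = diag_block_mat (map (\<lambda>(s, P). of_int s \<cdot>\<^sub>m product_dirac P) G)"

end

theory Submission
  imports Defs
begin

text \<open>
  Write \<open>s\<close> for multiplication by \<open>(-1)^dim\<close> on the functions on cells of a product complex \<open>P\<close>.
  The Leibniz rule for \<open>d\<close> says that the functions on the cells of \<open>P \<times> Q\<close> form the tensor product
  of those on the cells of \<open>P\<close> and of \<open>Q\<close>, with \<open>D(P \<times> Q) = D(P) \<otimes> 1 + s \<otimes> D(Q)\<close>. As \<open>d\<close>
  relates only cells whose dimensions differ by one, \<open>s\<close> anticommutes with \<open>D(P)\<close>; the mixed
  terms of the square therefore cancel.

  Concretely, for eigenfunctions \<open>f\<close> of \<open>D(P)\<close> and \<open>g\<close> of \<open>D(Q)\<close> with eigenvalues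
  \<open>\<lambda>\<close> and \<open>\<mu>\<close>, put \<open>u = f \<otimes> g\<close> and \<open>v = s f \<otimes> g\<close>. Then \<open>D(P \<times> Q)\<close> maps \<open>u\<close> to
  \<open>\<lambda> u + \<mu> v\<close> and \<open>v\<close> to \<open>\<mu> u - \<lambda> v\<close> (\<open>dirac_kernel_append\<close>, \<open>kernel_tensor_product\<close>).
  On the span of \<open>u\<close> and \<open>v\<close> its square is \<open>\<lambda>\<^sup>2 + \<mu>\<^sup>2\<close>, so at least one of the two square
  roots of that number is an eigenvalue (\<open>eigenvalue_of_reflection_pair\<close>).

  For signed complexes, the spectrum of a direct sum is the union of the spectra of the blocks
  (\<open>eigenvalue_diag_block_mat\<close>), the product has one block for each pair of summands, and the
  signs change an eigenvalue but not its square.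
\<close>

section \<open>Eigenfunctions of kernels\<close>

definition kernel_apply :: "'c set \<Rightarrow> ('c \<Rightarrow> 'c \<Rightarrow> real) \<Rightarrow> ('c \<Rightarrow> real) \<Rightarrow> 'c \<Rightarrow> real" where
  "kernel_apply A k f a = (\<Sum>b\<in>A. k a b * f b)"

text \<open>
  Indexing by cells instead of matrix positions makes the enumerations of the cells of two factors
  and of their product irrelevant to each other. Values outside \<open>A\<close> are ignored, so that
  eigenfunctions are compared on \<open>A\<close> only.
\<close>

definition kernel_eigenvalue :: "'c set \<Rightarrow> ('c \<Rightarrow> 'c \<Rightarrow> real) \<Rightarrow> real \<Rightarrow> bool" where
  "kernel_eigenvalue A k l \<longleftrightarrow>
     (\<exists>f. (\<exists>a\<in>A. f a \<noteq> 0) \<and> (\<forall>a\<in>A. kernel_apply A k f a = l * f a))"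

lemma kernel_apply_lincomb:
  "kernel_apply A k (\<lambda>a. p * f a + q * g a) a = p * kernel_apply A k f a + q * kernel_apply A k g a"
  unfolding kernel_apply_def by (simp add: sum.distrib sum_distrib_left algebra_simps)

lemma eigenvalue_mat_iff_kernel:
  assumes "distinct cs"
  shows "eigenvalue (mat (length cs) (length cs) (\<lambda>(i, j). k (cs ! i) (cs ! j))) l
    \<longleftrightarrow> kernel_eigenvalue (set cs) k l"
    (is "eigenvalue ?M l \<longleftrightarrow> _")
proof -
  let ?n = "length cs"
  have bij: "bij_betw ((!) cs) {0..<?n} (set cs)"
    using bij_betw_nth[OF assms refl refl] by (simp add: lessThan_atLeast0)
  have mult: "(?M *\<^sub>v vec ?n (\<lambda>i. f (cs ! i))) $ i = kernel_apply (set cs) k f (cs ! i)"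
    if "i < ?n" for f i
    using that sum.reindex_bij_betw[OF bij, of "\<lambda>b. k (cs ! i) b * f b"]
    by (simp add: scalar_prod_def kernel_apply_def)
  have eigvec: "eigenvector ?M (vec ?n (\<lambda>i. f (cs ! i))) l \<longleftrightarrow>
      (\<exists>a\<in>set cs. f a \<noteq> 0) \<and> (\<forall>a\<in>set cs. kernel_apply (set cs) k f a = l * f a)" for f
  proof -
    have "vec ?n (\<lambda>i. f (cs ! i)) = 0\<^sub>v ?n \<longleftrightarrow> (\<forall>i<?n. f (cs ! i) = 0)"
      by (auto simp: vec_eq_iff)
    moreover have "?M *\<^sub>v vec ?n (\<lambda>i. f (cs ! i)) = l \<cdot>\<^sub>v vec ?n (\<lambda>i. f (cs ! i)) \<longleftrightarrow>
        (\<forall>i<?n. kernel_apply (set cs) k f (cs ! i) = l * f (cs ! i))"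
      using mult by (auto simp: vec_eq_iff simp del: index_mult_mat_vec)
    ultimately show ?thesis
      unfolding eigenvector_def by (auto simp: all_set_conv_all_nth in_set_conv_nth)
  qed
  show ?thesis
  proof
    assume "eigenvalue ?M l"
    then obtain v where v: "eigenvector ?M v l" by (auto simp: eigenvalue_def)
    \<comment> \<open>A vector is a function on the positions, and every cell has exactly one position.\<close>
    define f where "f = (\<lambda>c. v $ the_inv_into {0..<?n} ((!) cs) c)"
    have "f (cs ! i) = v $ i" if "i < ?n" for i
      using that bij the_inv_into_f_f[of "(!) cs" "{0..<?n}" i]
      by (simp add: f_def bij_betw_def)
    moreover have "dim_vec v = ?n" using v by (auto simp: eigenvector_def)
    ultimately have "v = vec ?n (\<lambda>i. f (cs ! i))" by (auto simp: vec_eq_iff)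
    then show "kernel_eigenvalue (set cs) k l"
      using v eigvec unfolding kernel_eigenvalue_def by metis
  next
    assume "kernel_eigenvalue (set cs) k l"
    then show "eigenvalue ?M l"
      using eigvec unfolding kernel_eigenvalue_def eigenvalue_def by metis
  qed
qed

lemma kernel_eigenvalue_reindex:
  assumes "bij_betw \<phi> A B"
    and "kernel_eigenvalue A (\<lambda>a b. k (\<phi> a) (\<phi> b)) l"
  shows "kernel_eigenvalue B k l"
proof -
  from assms(2) obtain f where f: "\<exists>a\<in>A. f a \<noteq> 0"
    "\<And>a. a \<in> A \<Longrightarrow> kernel_apply A (\<lambda>a b. k (\<phi> a) (\<phi> b)) f a = l * f a"
    unfolding kernel_eigenvalue_def by blast
  define g where "g = f \<circ> the_inv_into A \<phi>"
  have g: "g (\<phi> a) = f a" if "a \<in> A" for a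
    using that assms(1) by (simp add: g_def bij_betw_def the_inv_into_f_f)
  have "kernel_apply B k g (\<phi> a) = kernel_apply A (\<lambda>a b. k (\<phi> a) (\<phi> b)) f a" for a
    unfolding kernel_apply_def sum.reindex_bij_betw[OF assms(1), symmetric]
    by (intro sum.cong) (auto simp: g)
  moreover have "B = \<phi> ` A" using assms(1) by (simp add: bij_betw_def)
  ultimately show ?thesis
    unfolding kernel_eigenvalue_def using f g by (intro exI[of _ g]) auto
qed

text \<open>
  Let \<open>\<rho>\<^sup>2 = \<lambda>\<^sup>2 + \<mu>\<^sup>2\<close>. Since \<open>k\<^sup>2 u = \<rho>\<^sup>2 u\<close>, that is \<open>(k - \<rho>) (k + \<rho>) u = 0\<close>, the function
  \<open>(k + \<rho>) u\<close> is an eigenfunction for \<open>\<rho>\<close>, unless it vanishes; then \<open>u\<close> is one for \<open>-\<rho>\<close>. The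
  functions \<open>u\<close> and \<open>v\<close> may be linearly dependent, and this is why the sign of the root cannot be
  chosen in advance.
\<close>

lemma eigenvalue_of_reflection_pair:
  assumes u: "\<And>a. a \<in> A \<Longrightarrow> kernel_apply A k u a = l * u a + m * v a"
    and v: "\<And>a. a \<in> A \<Longrightarrow> kernel_apply A k v a = m * u a - l * v a"
    and nz: "\<exists>a\<in>A. u a \<noteq> 0"
  shows "\<exists>r. kernel_eigenvalue A k r \<and> l\<^sup>2 + m\<^sup>2 = r\<^sup>2"
proof -
  define r where "r = sqrt (l\<^sup>2 + m\<^sup>2)"
  have r: "l\<^sup>2 + m\<^sup>2 = r\<^sup>2" by (simp add: r_def)
  define w where "w = (\<lambda>a. (l + r) * u a + m * v a)"
  have kw: "kernel_apply A k w a = r * w a" if "a \<in> A" for a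
  proof -
    have "kernel_apply A k w a = (l\<^sup>2 + m\<^sup>2) * u a + r * (l * u a + m * v a)"
      unfolding w_def kernel_apply_lincomb u[OF that] v[OF that]
      by (simp add: algebra_simps power2_eq_square)
    then show ?thesis unfolding r w_def by (simp add: algebra_simps power2_eq_square)
  qed
  show ?thesis
  proof (cases "\<exists>a\<in>A. w a \<noteq> 0")
    case True
    then have "kernel_eigenvalue A k r" unfolding kernel_eigenvalue_def using kw by blast
    with r show ?thesis by blast
  next
    case False
    have "kernel_apply A k u a = - r * u a" if "a \<in> A" for a
    proof -
      have "w a = 0" using False that by blast
      then show ?thesis using u[OF that] by (simp add: w_def algebra_simps)
    qed
    then have "kernel_eigenvalue A k (- r)" unfolding kernel_eigenvalue_def using nz by blast
    with r show ?thesis by (intro exI[of _ "- r"]) simp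
  qed
qed

text \<open>
  The kernel on pairs is \<open>k \<otimes> 1 + s \<otimes> l\<close>. The hypothesis on \<open>k\<close> says that \<open>k\<close> anticommutes with
  multiplication by \<open>s\<close>, so that \<open>s f\<close> is an eigenfunction of \<open>k\<close> for \<open>-\<lambda>\<close> whenever \<open>f\<close> is
  one for \<open>\<lambda>\<close>; the pair of functions is \<open>f \<otimes> g\<close> and \<open>s f \<otimes> g\<close>.
\<close>

lemma kernel_tensor_product:
  fixes s :: "'c \<Rightarrow> real"
  assumes fin: "finite A" "finite B"
    and s: "\<And>a. a \<in> A \<Longrightarrow> s a * s a = 1"
    and anti: "\<And>a b. a \<in> A \<Longrightarrow> b \<in> A \<Longrightarrow> k a b \<noteq> 0 \<Longrightarrow> s a = - s b"
    and K: "\<And>a a' b b'. a \<in> A \<Longrightarrow> b \<in> A \<Longrightarrow> a' \<in> B \<Longrightarrow> b' \<in> B \<Longrightarrow>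
      K (a, a') (b, b') = (if a' = b' then k a b else 0) + (if a = b then s a * l a' b' else 0)"
    and ev: "kernel_eigenvalue A k x" "kernel_eigenvalue B l y"
  shows "\<exists>z. kernel_eigenvalue (A \<times> B) K z \<and> x\<^sup>2 + y\<^sup>2 = z\<^sup>2"
proof -
  obtain f where f: "\<exists>a\<in>A. f a \<noteq> 0" "\<And>a. a \<in> A \<Longrightarrow> kernel_apply A k f a = x * f a"
    using ev(1) unfolding kernel_eigenvalue_def by blast
  obtain g where g: "\<exists>a\<in>B. g a \<noteq> 0" "\<And>a. a \<in> B \<Longrightarrow> kernel_apply B l g a = y * g a"
    using ev(2) unfolding kernel_eigenvalue_def by blast
  have tensor: "kernel_apply (A \<times> B) K (\<lambda>(a, b). h a * g b) (a, a')
      = kernel_apply A k h a * g a' + s a * h a * kernel_apply B l g a'"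
    if a: "a \<in> A" "a' \<in> B" for h a a'
  proof -
    have "kernel_apply (A \<times> B) K (\<lambda>(a, b). h a * g b) (a, a')
        = (\<Sum>b\<in>A. \<Sum>b'\<in>B. ((if a' = b' then k a b else 0)
             + (if a = b then s a * l a' b' else 0)) * (h b * g b'))"
      unfolding kernel_apply_def sum.cartesian_product
      by (intro sum.cong) (auto simp: K a)
    also have "\<dots> = (\<Sum>b\<in>A. \<Sum>b'\<in>B. (if a' = b' then k a b * h b * g b' else 0))
        + (\<Sum>b\<in>A. \<Sum>b'\<in>B. (if a = b then s a * h b * (l a' b' * g b') else 0))"
      unfolding sum.distrib[symmetric] by (intro sum.cong refl) (simp add: algebra_simps)
    also have "(\<Sum>b\<in>A. \<Sum>b'\<in>B. (if a' = b' then k a b * h b * g b' else 0))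
        = kernel_apply A k h a * g a'"
      using fin a by (simp add: kernel_apply_def sum_distrib_right)
    also have "(\<Sum>b\<in>A. \<Sum>b'\<in>B. (if a = b then s a * h b * (l a' b' * g b') else 0))
        = (\<Sum>b\<in>A. if a = b then (\<Sum>b'\<in>B. s a * h b * (l a' b' * g b')) else 0)"
      by (intro sum.cong refl) simp
    also have "\<dots> = s a * h a * kernel_apply B l g a'"
      using fin a by (simp add: kernel_apply_def sum_distrib_left)
    finally show ?thesis .
  qed
  have sf: "kernel_apply A k (\<lambda>b. s b * f b) a = - x * (s a * f a)" if a: "a \<in> A" for a
  proof -
    have "k a b * (s b * f b) = - s a * (k a b * f b)" if "b \<in> A" for b
      using anti[OF a that] by (cases "k a b = 0") auto
    then have "kernel_apply A k (\<lambda>b. s b * f b) a = - s a * kernel_apply A k f a"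
      unfolding kernel_apply_def sum_distrib_left by (intro sum.cong) auto
    then show ?thesis using f(2)[OF a] by simp
  qed
  define u where "u = (\<lambda>(a, b). f a * g b)"
  define v where "v = (\<lambda>(a, b). (s a * f a) * g b)"
  show ?thesis
  proof (rule eigenvalue_of_reflection_pair[where u = u and v = v])
    fix c assume c: "c \<in> A \<times> B"
    then obtain a a' where ca: "c = (a, a')" and a: "a \<in> A" "a' \<in> B" by blast
    show "kernel_apply (A \<times> B) K u c = x * u c + y * v c"
      unfolding u_def ca tensor[OF a] f(2)[OF a(1)] g(2)[OF a(2)]
      by (simp add: v_def algebra_simps)
    have ssf: "s a * (s a * f a) = f a" using s[OF a(1)] by (simp flip: mult.assoc)
    show "kernel_apply (A \<times> B) K v c = y * u c - x * v c"
      unfolding v_def ca tensor[OF a] sf[OF a(1)] g(2)[OF a(2)] ssf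
      by (simp add: u_def algebra_simps)
  next
    show "\<exists>c\<in>A \<times> B. u c \<noteq> 0" using f(1) g(1) by (auto simp: u_def)
  qed
qed

section \<open>The exterior derivative of a product\<close>

lemma cells_Nil [simp]: "cells [] = {[]}"
  by (simp add: cells_def)

lemma cells_Cons: "cells (K # P) = (\<lambda>(x, xs). x # xs) ` (simplices K \<times> cells P)"
  by (auto simp: cells_def set_Cons_def)

lemma length_cells: "c \<in> cells P \<Longrightarrow> length c = length P"
  by (induction P arbitrary: c) (auto simp: cells_Cons)

lemma bij_betw_append_cells:
  "bij_betw (\<lambda>(a, b). a @ b) (cells P \<times> cells Q) (cells (P @ Q))"
proof -
  have "(\<lambda>(a, b). a @ b) ` (cells P \<times> cells Q) = cells (P @ Q)"
  proof (induction P)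
    case Nil
    have "c \<in> (\<lambda>(a, b). a @ b) ` ({[]} \<times> cells Q)" if "c \<in> cells Q" for c
      using that by (intro image_eqI[of _ _ "([], c)"]) simp_all
    then show ?case by auto
  next
    case (Cons K P)
    show ?case
    proof (intro equalityI subsetI)
      fix c assume "c \<in> (\<lambda>(a, b). a @ b) ` (cells (K # P) \<times> cells Q)"
      then obtain x a b where c: "c = x # (a @ b)" "x \<in> simplices K" "a \<in> cells P" "b \<in> cells Q"
        unfolding cells_Cons by (elim imageE SigmaE) simp
      have "a @ b \<in> cells (P @ Q)"
        unfolding Cons.IH[symmetric] using c by (intro image_eqI[of _ _ "(a, b)"]) simp_all
      then show "c \<in> cells ((K # P) @ Q)"
        unfolding append_Cons cells_Cons using c by (intro image_eqI[of _ _ "(x, a @ b)"]) simp_all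
    next
      fix c assume "c \<in> cells ((K # P) @ Q)"
      then obtain x a b where c: "c = x # (a @ b)" "x \<in> simplices K" "a \<in> cells P" "b \<in> cells Q"
        unfolding append_Cons cells_Cons Cons.IH[symmetric] by (elim imageE SigmaE) simp
      then have "x # a \<in> cells (K # P)"
        unfolding cells_Cons by (intro image_eqI[of _ _ "(x, a)"]) simp_all
      then show "c \<in> (\<lambda>(a, b). a @ b) ` (cells (K # P) \<times> cells Q)"
        using c by (intro image_eqI[of _ _ "(x # a, b)"]) simp_all
    qed
  qed
  moreover have "inj_on (\<lambda>(a, b). a @ b) (cells P \<times> cells Q)"
    by (intro inj_onI) (clarsimp simp: length_cells)
  ultimately show ?thesis by (simp add: bij_betw_def)
qed

lemma oriented_complex_finite:
  assumes "oriented_complex K"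
  shows "finite (simplices K)" and "x \<in> simplices K \<Longrightarrow> finite x \<and> x \<noteq> {}"
  using assms by (simp_all add: oriented_complex_def simplicial_complex_def)

lemma finite_cells:
  assumes "\<forall>K\<in>set P. oriented_complex K"
  shows "finite (cells P)"
  using assms
  by (induction P) (simp_all add: cells_Cons oriented_complex_finite(1))

lemma ext_deriv_zero: "ext_deriv P (\<lambda>c. 0) a = 0"
proof (induction P arbitrary: a)
  case (Cons K P)
  then show ?case by (cases a) (simp_all add: simplex_deriv_def)
qed simp

definition parity :: "'a set list \<Rightarrow> real" where
  "parity a = (-1) ^ sum_list (map simplex_dim a)"

lemma parity_simps [simp]: "parity [] = 1" "parity (x # xs) = (-1) ^ simplex_dim x * parity xs"
  by (simp_all add: parity_def power_add)

lemma parity_square: "parity a * parity a = 1"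
  unfolding parity_def power_add[symmetric] by simp

lemma ext_deriv_append:
  assumes "a \<in> cells P"
  shows "ext_deriv (P @ Q) f (a @ a')
    = ext_deriv P (\<lambda>b. f (b @ a')) a + parity a * ext_deriv Q (\<lambda>b'. f (a @ b')) a'"
  using assms
  by (induction P arbitrary: a f) (auto simp: cells_Cons algebra_simps)

definition ext_deriv_kernel :: "'a product_complex \<Rightarrow> 'a set list \<Rightarrow> 'a set list \<Rightarrow> real" where
  "ext_deriv_kernel P a b = ext_deriv P (\<lambda>c. if c = b then 1 else 0) a"

definition dirac_kernel :: "'a product_complex \<Rightarrow> 'a set list \<Rightarrow> 'a set list \<Rightarrow> real" where
  "dirac_kernel P a b = ext_deriv_kernel P a b + ext_deriv_kernel P b a"

lemma ext_deriv_kernel_append: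
  assumes "a \<in> cells P" "b \<in> cells P" "a' \<in> cells Q" "b' \<in> cells Q"
  shows "ext_deriv_kernel (P @ Q) (a @ a') (b @ b')
    = (if a' = b' then ext_deriv_kernel P a b else 0)
      + (if a = b then parity a * ext_deriv_kernel Q a' b' else 0)"
proof -
  have "length a = length b" "length a' = length b'"
    using assms by (simp_all add: length_cells)
  then have "(\<lambda>c. if c @ a' = b @ b' then 1 else 0 :: real)
      = (if a' = b' then (\<lambda>c. if c = b then 1 else 0) else (\<lambda>c. 0))"
    "(\<lambda>c. if a @ c = b @ b' then 1 else 0 :: real)
      = (if a = b then (\<lambda>c. if c = b' then 1 else 0) else (\<lambda>c. 0))"
    by (auto simp: fun_eq_iff)
  then show ?thesis
    by (simp add: ext_deriv_kernel_def ext_deriv_append[OF assms(1)] ext_deriv_zero)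
qed

lemma dirac_kernel_append:
  assumes "a \<in> cells P" "b \<in> cells P" "a' \<in> cells Q" "b' \<in> cells Q"
  shows "dirac_kernel (P @ Q) (a @ a') (b @ b')
    = (if a' = b' then dirac_kernel P a b else 0)
      + (if a = b then parity a * dirac_kernel Q a' b' else 0)"
  unfolding dirac_kernel_def
    ext_deriv_kernel_append[OF assms] ext_deriv_kernel_append[OF assms(2,1,4,3)]
  by (auto simp: algebra_simps)

text \<open>
  A face of \<open>x\<close> arises by omitting one of the distinct vertices of \<open>x\<close>. It has to be non-empty:
  with truncated subtraction the empty set would have dimension 0, like a vertex.
\<close>

lemma boundary_coeff_nonzero_dim:
  assumes K: "oriented_complex K" and x: "x \<in> simplices K" and y: "y \<in> simplices K"
    and nz: "boundary_coeff K x y \<noteq> 0"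
  shows "simplex_dim x = Suc (simplex_dim y)"
proof -
  let ?xs = "orient K x"
  have xs: "distinct ?xs" "set ?xs = x" using K x by (simp_all add: oriented_complex_def)
  have fin: "finite y" "y \<noteq> {}"
    using oriented_complex_finite(2)[OF K y] by simp_all
  obtain i where i: "i < length ?xs" "set (omit_nth i ?xs) = y"
    using nz unfolding boundary_coeff_def by (auto elim: sum.not_neutral_contains_not_neutral)
  have "distinct (omit_nth i ?xs)"
    unfolding omit_nth_def using xs(1) set_take_disj_set_drop_if_distinct[of ?xs i "Suc i"] by auto
  then have "card y = length (omit_nth i ?xs)"
    using i(2) distinct_card by metis
  also have "\<dots> = length ?xs - 1" using i(1) by (simp add: omit_nth_def)
  also have "length ?xs = card x" using xs distinct_card by metis
  finally have "card y = card x - 1" .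
  moreover have "card y > 0" using fin by (simp add: card_gt_0_iff)
  ultimately show ?thesis by (simp add: simplex_dim_def)
qed

lemma ext_deriv_kernel_Cons:
  assumes "finite (simplices K)" "y \<in> simplices K"
  shows "ext_deriv_kernel (K # P) (x # xs) (y # ys)
    = (if xs = ys then of_int (boundary_coeff K x y) else 0)
      + (if x = y then (-1) ^ simplex_dim x * ext_deriv_kernel P xs ys else 0)"
proof -
  have "simplex_deriv K (\<lambda>z. if z # xs = y # ys then 1 else 0) x
      = (if xs = ys then of_int (boundary_coeff K x y) else 0)"
    using assms by (simp add: simplex_deriv_def if_distrib cong: if_cong)
  moreover have "(\<lambda>zs. if x # zs = y # ys then 1 else 0 :: real)
      = (if x = y then (\<lambda>zs. if zs = ys then 1 else 0) else (\<lambda>zs. 0))"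
    by (auto simp: fun_eq_iff)
  ultimately show ?thesis by (simp add: ext_deriv_kernel_def ext_deriv_zero)
qed

text \<open>
  The derivative moves in one factor at a time, where it changes the dimension by one, and leaves
  the other factors alone.
\<close>

lemma ext_deriv_kernel_parity:
  assumes "\<forall>K\<in>set P. oriented_complex K"
    and "a \<in> cells P" "b \<in> cells P" "ext_deriv_kernel P a b \<noteq> 0"
  shows "parity a = - parity b"
  using assms
proof (induction P arbitrary: a b)
  case Nil
  then show ?case by (simp add: ext_deriv_kernel_def)
next
  case (Cons K P)
  from Cons.prems obtain x xs y ys where ab: "a = x # xs" "b = y # ys"
    and mem: "x \<in> simplices K" "y \<in> simplices K" "xs \<in> cells P" "ys \<in> cells P"
    by (auto simp: cells_Cons)
  have K: "oriented_complex K" using Cons.prems by simp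
  have "xs = ys \<and> boundary_coeff K x y \<noteq> 0 \<or> x = y \<and> ext_deriv_kernel P xs ys \<noteq> 0"
    using Cons.prems(4) unfolding ab
    by (auto simp: ext_deriv_kernel_Cons oriented_complex_finite(1)[OF K] mem split: if_splits)
  then show ?case
    using boundary_coeff_nonzero_dim[OF K mem(1,2)] Cons.IH[OF _ mem(3,4)] Cons.prems(1)
    by (auto simp: ab)
qed

lemma dirac_kernel_parity:
  assumes "\<forall>K\<in>set P. oriented_complex K"
    and "a \<in> cells P" "b \<in> cells P" "dirac_kernel P a b \<noteq> 0"
  shows "parity a = - parity b"
proof (cases "ext_deriv_kernel P a b = 0")
  case True
  with assms(4) have "ext_deriv_kernel P b a \<noteq> 0" by (simp add: dirac_kernel_def)
  from ext_deriv_kernel_parity[OF assms(1,3,2) this] show ?thesis by simp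
qed (rule ext_deriv_kernel_parity[OF assms(1-3)])

lemma kernel_eigenvalue_dirac_append:
  assumes "\<forall>K\<in>set P. oriented_complex K" "\<forall>K\<in>set Q. oriented_complex K"
    and "kernel_eigenvalue (cells P) (dirac_kernel P) x"
    and "kernel_eigenvalue (cells Q) (dirac_kernel Q) y"
  shows "\<exists>z. kernel_eigenvalue (cells (P @ Q)) (dirac_kernel (P @ Q)) z \<and> x\<^sup>2 + y\<^sup>2 = z\<^sup>2"
proof -
  let ?app = "\<lambda>(a, b). a @ b"
  have "\<exists>z. kernel_eigenvalue (cells P \<times> cells Q)
      (\<lambda>c c'. dirac_kernel (P @ Q) (?app c) (?app c')) z \<and> x\<^sup>2 + y\<^sup>2 = z\<^sup>2"
  proof (rule kernel_tensor_product
      [where s = parity and k = "dirac_kernel P" and l = "dirac_kernel Q"])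
    show "finite (cells P)" "finite (cells Q)" using assms(1,2) by (simp_all add: finite_cells)
  next
    show "parity a = - parity b"
      if "a \<in> cells P" "b \<in> cells P" "dirac_kernel P a b \<noteq> 0" for a b
      using dirac_kernel_parity[OF assms(1) that] .
  qed (simp_all only: parity_square dirac_kernel_append prod.case assms(3,4))
  then show ?thesis using kernel_eigenvalue_reindex[OF bij_betw_append_cells] by blast
qed

section \<open>Dirac matrices and direct sums\<close>

lemma product_dirac_carrier:
  "product_dirac P \<in> carrier_mat (length (cell_list P)) (length (cell_list P))"
  by (simp add: product_dirac_def ext_deriv_mat_def Let_def)

lemma eigenvalue_product_dirac:
  assumes "\<forall>K\<in>set P. oriented_complex K"
  shows "eigenvalue (product_dirac P) x \<longleftrightarrow> kernel_eigenvalue (cells P) (dirac_kernel P) x"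
proof -
  let ?cs = "cell_list P"
  have cs: "distinct ?cs \<and> set ?cs = cells P"
    unfolding cell_list_def
    by (rule someI_ex[where P = "\<lambda>cs. distinct cs \<and> set cs = cells P"])
      (use finite_distinct_list[OF finite_cells[OF assms]] in blast)
  have "product_dirac P
      = mat (length ?cs) (length ?cs) (\<lambda>(i, j). dirac_kernel P (?cs ! i) (?cs ! j))"
    by (rule eq_matI)
      (auto simp: product_dirac_def ext_deriv_mat_def Let_def dirac_kernel_def ext_deriv_kernel_def)
  then show ?thesis using eigenvalue_mat_iff_kernel[of ?cs "dirac_kernel P" x] cs by simp
qed

lemma eigenvalue_smult_mat:
  fixes A :: "'b :: comm_ring_1 mat"
  assumes "square_mat A" and "eigenvalue A x"
  shows "eigenvalue (c \<cdot>\<^sub>m A) (c * x)"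
proof -
  from assms(2) obtain v where v: "v \<in> carrier_vec (dim_row A)" "v \<noteq> 0\<^sub>v (dim_row A)"
    "A *\<^sub>v v = x \<cdot>\<^sub>v v"
    by (auto simp: eigenvalue_def eigenvector_def)
  have "dim_vec v = dim_col A" using v(1) assms(1) by simp
  then have "(c \<cdot>\<^sub>m A) *\<^sub>v v = c \<cdot>\<^sub>v (A *\<^sub>v v)"
    by (intro eq_vecI) (auto simp: scalar_prod_def sum_distrib_left mult.assoc)
  then show ?thesis
    using v unfolding eigenvalue_def eigenvector_def
    by (intro exI[of _ v]) (simp add: smult_smult_assoc)
qed

lemma eigenvalue_signed_mat:
  fixes A :: "real mat"
  assumes "square_mat A" and "s \<in> {1, -1 :: int}"
  shows "eigenvalue (of_int s \<cdot>\<^sub>m A) x \<longleftrightarrow> eigenvalue A (of_int s * x)"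
proof
  have ss: "real_of_int s * real_of_int s = 1" using assms(2) by auto
  have ssA: "of_int s \<cdot>\<^sub>m (of_int s \<cdot>\<^sub>m A) = A"
    by (rule eq_matI) (simp_all add: ss flip: mult.assoc)
  {
    assume "eigenvalue (of_int s \<cdot>\<^sub>m A) x"
    from eigenvalue_smult_mat[OF _ this, of "of_int s"]
    show "eigenvalue A (of_int s * x)"
      using assms(1) ssA by simp
  next
    assume "eigenvalue A (of_int s * x)"
    from eigenvalue_smult_mat[OF assms(1) this, of "of_int s"]
    show "eigenvalue (of_int s \<cdot>\<^sub>m A) x"
      by (simp add: ss flip: mult.assoc)
  }
qed

text \<open>
  The characteristic determinant of a direct sum is the product of those of the summands. The
  empty sum fits in, since a matrix of size zero has no non-zero vectors to act on.
\<close>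

lemma eigenvalue_diag_block_mat:
  fixes As :: "'b :: field mat list"
  assumes "\<forall>A\<in>set As. square_mat A"
  shows "eigenvalue (diag_block_mat As) x \<longleftrightarrow> (\<exists>A\<in>set As. eigenvalue A x)"
  using assms
proof (induction As)
  case Nil
  then show ?case
    by (auto simp: eigenvalue_def eigenvector_def)
next
  case (Cons A As)
  let ?B = "diag_block_mat As"
  have sq: "square_mat A" "square_mat ?B"
    using Cons.prems diag_block_mat_square[of As] by auto
  define n m where "n = dim_row A" and "m = dim_row ?B"
  have A: "A \<in> carrier_mat n n" and B: "?B \<in> carrier_mat m m"
    using sq by (auto simp: n_def m_def)
  have AB: "diag_block_mat (A # As) = four_block_mat A (0\<^sub>m n m) (0\<^sub>m m n) ?B"
    using A B by (simp add: Let_def)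
  have carr: "diag_block_mat (A # As) \<in> carrier_mat (n + m) (n + m)"
    unfolding AB by (rule four_block_carrier_mat[OF A B])
  have "char_matrix (diag_block_mat (A # As)) x
      = four_block_mat (char_matrix A x) (0\<^sub>m n m) (0\<^sub>m m n) (char_matrix ?B x)"
    unfolding AB by (rule eq_matI) (use A B in \<open>auto simp: char_matrix_def\<close>)
  moreover have "char_matrix A x \<in> carrier_mat n n" "char_matrix ?B x \<in> carrier_mat m m"
    using A B by (auto simp: char_matrix_def)
  ultimately have "det (char_matrix (diag_block_mat (A # As)) x)
      = det (char_matrix A x) * det (char_matrix ?B x)"
    by (simp add: det_four_block_mat_lower_left_zero[where n = n and m = m])
  then have "eigenvalue (diag_block_mat (A # As)) x \<longleftrightarrow> eigenvalue A x \<or> eigenvalue ?B x"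
    by (simp add: eigenvalue_det[OF A] eigenvalue_det[OF B] eigenvalue_det[OF carr]
        del: diag_block_mat.simps)
  then show ?case using Cons by (simp del: diag_block_mat.simps)
qed

lemma eigenvalue_dirac:
  fixes G :: "'a signed_complex"
  assumes "\<forall>(s, P)\<in>set G. s \<in> {1, -1}"
  shows "eigenvalue (dirac G) x \<longleftrightarrow>
    (\<exists>(s, P)\<in>set G. eigenvalue (product_dirac P) (of_int s * x))"
proof -
  have sq: "square_mat (product_dirac P)" for P :: "'a product_complex"
    using product_dirac_carrier[of P] by auto
  have "eigenvalue (dirac G) x \<longleftrightarrow>
      (\<exists>(s, P)\<in>set G. eigenvalue (of_int s \<cdot>\<^sub>m product_dirac P) x)"
    unfolding dirac_def
    by (subst eigenvalue_diag_block_mat) (use sq in \<open>auto simp: split_def\<close>)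
  also have "\<dots> \<longleftrightarrow> (\<exists>(s, P)\<in>set G. eigenvalue (product_dirac P) (of_int s * x))"
  proof (rule bex_cong[OF refl])
    fix sP assume "sP \<in> set G"
    then have "fst sP \<in> {1, -1}" using assms by (simp add: case_prod_beta)
    then show "(case sP of (s, P) \<Rightarrow> eigenvalue (of_int s \<cdot>\<^sub>m product_dirac P) x) \<longleftrightarrow>
        (case sP of (s, P) \<Rightarrow> eigenvalue (product_dirac P) (of_int s * x))"
      by (simp only: case_prod_beta eigenvalue_signed_mat[OF sq])
  qed
  finally show ?thesis .
qed

theorem theorem15:
  fixes G1 G2 :: "'a signed_complex" and l1 l2 :: real
  assumes "signed_complex G1" and "signed_complex G2"
    and "eigenvalue (dirac G1) l1" and "eigenvalue (dirac G2) l2"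
  shows "\<exists>l12. eigenvalue (dirac (signed_product G1 G2)) l12 \<and> l1\<^sup>2 + l2\<^sup>2 = l12\<^sup>2"
proof -
  have signs: "\<forall>(s, P)\<in>set G1. s \<in> {1, -1}" "\<forall>(s, P)\<in>set G2. s \<in> {1, -1}"
    using assms(1,2) by (auto simp: signed_complex_def)
  obtain s P where P: "(s, P) \<in> set G1" "eigenvalue (product_dirac P) (of_int s * l1)"
    using assms(3) eigenvalue_dirac[OF signs(1)] by auto
  obtain t Q where Q: "(t, Q) \<in> set G2" "eigenvalue (product_dirac Q) (of_int t * l2)"
    using assms(4) eigenvalue_dirac[OF signs(2)] by auto
  have st: "s \<in> {1, -1}" "t \<in> {1, -1}" using signs P(1) Q(1) by auto
  have oP: "\<forall>K\<in>set P. oriented_complex K" and oQ: "\<forall>K\<in>set Q. oriented_complex K"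
    using assms(1,2) P(1) Q(1) by (auto simp: signed_complex_def)
  then have oPQ: "\<forall>K\<in>set (P @ Q). oriented_complex K" by auto
  obtain z where z: "eigenvalue (product_dirac (P @ Q)) z"
    "(of_int s * l1)\<^sup>2 + (of_int t * l2)\<^sup>2 = z\<^sup>2"
    using kernel_eigenvalue_dirac_append[OF oP oQ] P(2) Q(2)
    unfolding eigenvalue_product_dirac[OF oP] eigenvalue_product_dirac[OF oQ]
      eigenvalue_product_dirac[OF oPQ] by blast
  have signs12: "\<forall>(s, P)\<in>set (signed_product G1 G2). s \<in> {1, -1}"
  proof
    fix p assume "p \<in> set (signed_product G1 G2)"
    then obtain s P t Q where "(s, P) \<in> set G1" "(t, Q) \<in> set G2" "p = (s * t, P @ Q)"
      unfolding signed_product_def by auto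
    then show "case p of (s, P) \<Rightarrow> s \<in> {1, -1}"
      using bspec[OF signs(1)] bspec[OF signs(2)] by fastforce
  qed
  have "(s * t, P @ Q) \<in> set (signed_product G1 G2)"
    unfolding signed_product_def set_map set_product
    using P(1) Q(1) by (intro image_eqI[of _ _ "((s, P), (t, Q))"]) simp_all
  moreover have "of_int (s * t) * (of_int (s * t) * z) = z" using st by auto
  then have "eigenvalue (product_dirac (P @ Q)) (of_int (s * t) * (of_int (s * t) * z))"
    using z(1) by (simp only:)
  ultimately have "eigenvalue (dirac (signed_product G1 G2)) (of_int (s * t) * z)"
    unfolding eigenvalue_dirac[OF signs12] by blast
  moreover have "l1\<^sup>2 + l2\<^sup>2 = (of_int (s * t) * z)\<^sup>2"
    using z(2) st by auto
  ultimately show ?thesis by blast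
qed

end
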